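(* Let $W$ be a non-negative integer-valued random variable with mean $\mu$ and variance $\sigma^2$, let $a<\mu$ be an integer and $\lambda=\mu-a$. Then for integer $k>\lambda$, $$\left|\frac{\mathbb P(W-a\ge k)}{\mathbb P(Y\ge k)}-1\right|\le C_1(\lambda,k)\big\{\mu\,\mathbb E|W+1-W^s|+|\mu-\lambda|\big\}+\mathbb P(W-a<-1),$$ where $Y\sim\mathrm{Pn}(\lambda)$ and $W^s$ is a random variable, defined on the same probability space as $W$, having the $W$-size biased distribution.
   Context: $\mathrm{Pn}(\lambda)$ is the Poisson distribution with mean $\lambda$. For $Y\sim\mathrm{Pn}(\lambda)$ write $F(j)=\mathbb P(Y\le j)$, $\overline F(j)=\mathbb P(Y\ge j)$, and $$C_1(\lambda,k):=\frac{F(k-1)}{k\,\mathbb P(Y=k)}\left\{1-\min\left(\frac{F(k-2)}{F(k-1)}\cdot\frac{\lambda}{k-1},\ \frac{\overline F(k+1)}{\overline F(k)}\cdot\frac{k}{\lambda}\right)\right\}.$$ For a non-negative random variable $W$ with mean $\mu\in(0,\infty)$ and distribution $dF_W(w)$, the $W$-size biased distribution is $dF_W^s(w)=w\,dF_W(w)/\mu$, $w\ge0$; equivalently, it is characterised by $\mathbb E[Wg(W)]=\mu\,\mathbb E g(W^s)$ for all $g$ with $\mathbb E|Wg(W)|<\infty$. *)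

theory Defs
  imports "HOL-Probability.Probability"
begin

definition poisson_F :: "real \<Rightarrow> int \<Rightarrow> real" where
  "poisson_F lam j = measure_pmf.prob (poisson_pmf lam) {y. int y \<le> j}"

definition poisson_Fbar :: "real \<Rightarrow> int \<Rightarrow> real" where
  "poisson_Fbar lam j = measure_pmf.prob (poisson_pmf lam) {y. int y \<ge> j}"

(* For k = 1 the first argument of the minimum contains the factors F(-1) = 0 and lam / 0;
   it is read as 0, which is what HOL's x / 0 = 0 gives. *)
definition C1 :: "real \<Rightarrow> int \<Rightarrow> real" where
  "C1 lam k =
     poisson_F lam (k - 1) / (of_int k * measure_pmf.prob (poisson_pmf lam) {y. int y = k}) *
     (1 - min (poisson_F lam (k - 2) / poisson_F lam (k - 1) * (lam / of_int (k - 1)))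
              (poisson_Fbar lam (k + 1) / poisson_Fbar lam k * (of_int k / lam)))"

(* Meaningful for a distribution N on the non-negative reals with mean in (0, \<infinity>). *)
definition size_biased :: "real measure \<Rightarrow> real measure" where
  "size_biased N = density N (\<lambda>w. ennreal (w / (\<integral>x. x \<partial>N)))"

end

(* Stein's method for the indicator of [k, \<infinity>). The solution of the Stein equation
   lam g(j+1) - j g(j) = 1 - 1[j >= k] / Fbar(k) is F(j-1) / (j P(Y=j)) for 1 <= j <= k and a multiple of
   Fbar(j) / (j P(Y=j)) for j >= k. The first is increasing and convex, the second decreasing and
   convex, so the largest increments of g are those next to k, and the larger of the two is C1.
   The size-bias identity turns E[lam g(X+1) - X g(X)], X = W - a, into
   mu E[g(W+1-a) - g(Ws-a)] - a E[g(X+1) - g(X)]. *)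

theory Submission
  imports Defs
begin

section \<open>Cumulative, tail and point probabilities of the Poisson distribution\<close>

lemma poisson_F_nat: "poisson_F l (int n) = (\<Sum>i\<le>n. pmf (poisson_pmf l) i)"
proof -
  have "{y. int y \<le> int n} = {..n}" by auto
  then show ?thesis by (simp add: poisson_F_def measure_measure_pmf_finite)
qed

lemma poisson_Fbar_sums: "(\<lambda>i. pmf (poisson_pmf l) (n + i)) sums poisson_Fbar l (int n)"
proof -
  have "(\<lambda>i. measure_pmf.prob (poisson_pmf l) {n + i}) sums
      measure_pmf.prob (poisson_pmf l) (\<Union>i. {n + i})"
    by (rule measure_pmf.finite_measure_UNION) (auto simp: disjoint_family_on_def)
  moreover have "(\<Union>i. {n + i}) = {y. int y \<ge> int n}"
    by (auto simp: image_iff) (metis le_Suc_ex)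
  ultimately show ?thesis by (simp add: poisson_Fbar_def measure_pmf_single)
qed

lemma poisson_Fbar_Suc: "poisson_Fbar l (int n) = pmf (poisson_pmf l) n + poisson_Fbar l (int (Suc n))"
proof -
  have "(\<lambda>i. pmf (poisson_pmf l) (n + Suc i)) sums poisson_Fbar l (int (Suc n))"
    using poisson_Fbar_sums[of l "Suc n"] by simp
  from sums_Suc[OF this] show ?thesis
    using poisson_Fbar_sums[of l n] by (auto dest: sums_unique2)
qed

lemma poisson_F_Fbar: "poisson_F l (int n) + poisson_Fbar l (int (Suc n)) = 1"
proof -
  have "{y. int y \<ge> int (Suc n)} = UNIV - {y. int y \<le> int n}" by auto
  then show ?thesis
    using measure_pmf.prob_compl[of "{y. int y \<le> int n}" "poisson_pmf l"]
    by (simp add: poisson_F_def poisson_Fbar_def)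
qed

lemma poisson_pmf_Suc: "0 < l \<Longrightarrow> real (Suc n) * pmf (poisson_pmf l) (Suc n) = l * pmf (poisson_pmf l) n"
  by simp

lemma poisson_pmf_pos: "0 < l \<Longrightarrow> 0 < pmf (poisson_pmf l) n"
  by simp

lemma poisson_Fbar_pos:
  assumes "0 < l" shows "0 < poisson_Fbar l (int n)"
proof -
  have "0 \<le> poisson_Fbar l (int (Suc n))" by (simp add: poisson_Fbar_def)
  then show ?thesis using poisson_Fbar_Suc[of l n] poisson_pmf_pos[OF assms, of n] by linarith
qed

section \<open>The two branches of the Stein solution: recursions, monotonicity and
  convexity\<close>

text \<open>The index is shifted by one: this is F(j-1) / (j P(Y=j)) at j = n+1, rewritten by (n+1)
  P(Y=n+1) = l P(Y=n).\<close>

definition poisson_left :: "real \<Rightarrow> nat \<Rightarrow> real" where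
  "poisson_left l n = poisson_F l (int n) / (l * pmf (poisson_pmf l) n)"

text \<open>Unlike in \<open>poisson_left\<close>, \<open>n\<close> is the argument of the Stein
  solution itself. At 0 the quotient is 0 by the convention for division, so recursion and
  monotonicity start at 1.\<close>

definition poisson_right :: "real \<Rightarrow> nat \<Rightarrow> real" where
  "poisson_right l n = poisson_Fbar l (int n) / (real n * pmf (poisson_pmf l) n)"

lemma poisson_left_0: "0 < l \<Longrightarrow> poisson_left l 0 = 1 / l"
  using poisson_F_nat[of l 0] by (simp add: poisson_left_def)

text \<open>The Stein equation below the jump: divide F(n+1) = F(n) + P(Y=n+1) by P(Y=n+1).\<close>

lemma poisson_left_Suc:
  assumes "0 < l"
  shows "l * poisson_left l (Suc n) = 1 + real (Suc n) * poisson_left l n"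
proof -
  define p where "p = pmf (poisson_pmf l)"
  have p: "p n > 0" and q: "p (Suc n) = l * p n / real (Suc n)"
    using poisson_pmf_pos[OF assms] poisson_pmf_Suc[OF assms, of n]
    by (simp_all add: p_def field_simps del: pmf_poisson of_nat_Suc)
  have "poisson_F l (int (Suc n)) = poisson_F l (int n) + p (Suc n)"
    unfolding poisson_F_nat by (simp add: p_def)
  then show ?thesis
    using assms p unfolding poisson_left_def p_def[symmetric] q
    by (simp add: field_simps del: of_nat_Suc)
qed

text \<open>Let A be the branch and d(n) = A(n+1) - A(n). Subtracting consecutive recursions gives l
  d(n+1) = A(n+1) + (n+1) d(n), and once more l (d(n+2) - d(n+1)) = 2 d(n+1) + (n+1) (d(n+1) -
  d(n)). The right side is nonnegative by both claims at n, so one induction carries the two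
  together.\<close>

lemma poisson_left_convex:
  assumes l: "0 < l"
  shows "0 < poisson_left l (Suc n) - poisson_left l n \<and>
    poisson_left l (Suc n) - poisson_left l n \<le> poisson_left l (Suc (Suc n)) - poisson_left l (Suc n)"
proof -
  let ?A = "poisson_left l"
  note S = poisson_left_Suc[OF l]
  have rec: "l * (?A (Suc (Suc n)) - ?A (Suc n)) = ?A (Suc n) + real (Suc n) * (?A (Suc n) - ?A n)" for n
    using S[of "Suc n"] S[of n] by (simp add: algebra_simps)
  show ?thesis
  proof (induction n)
    case 0
    have d: "?A (Suc 0) - ?A 0 = 1 / l\<^sup>2"
      using S[of 0] l by (simp add: poisson_left_0 field_simps power2_eq_square)
    \<comment> \<open>Base case: l A(0) = 1 turns the first recursion into l d(0) = A(0), while l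
      d(1) = A(1) + d(0) is larger because A(1) > A(0).\<close>
    have "l * (?A (Suc 0) - ?A 0) = ?A 0"
      using S[of 0] l by (simp add: poisson_left_0 right_diff_distrib)
    moreover have "l * (?A (Suc (Suc 0)) - ?A (Suc 0)) = ?A (Suc 0) + (?A (Suc 0) - ?A 0)"
      unfolding rec by simp
    moreover have "?A (Suc 0) - ?A 0 > 0" using d l by simp
    ultimately have "l * (?A (Suc 0) - ?A 0) \<le> l * (?A (Suc (Suc 0)) - ?A (Suc 0))" by linarith
    then have "?A (Suc 0) - ?A 0 \<le> ?A (Suc (Suc 0)) - ?A (Suc 0)" using l by simp
    then show ?case using \<open>?A (Suc 0) - ?A 0 > 0\<close> by blast
  next
    case (Suc n)
    define d where "d i = ?A (Suc i) - ?A i" for i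
    have ih: "0 < d n" "d n \<le> d (Suc n)" using Suc by (auto simp: d_def)
    have "l * d (Suc (Suc n)) = ?A (Suc (Suc n)) + real (Suc (Suc n)) * d (Suc n)"
      and "l * d (Suc n) = ?A (Suc n) + real (Suc n) * d n"
      using rec unfolding d_def by blast+
    then have "l * d (Suc (Suc n)) - l * d (Suc n) = 2 * d (Suc n) + real (Suc n) * (d (Suc n) - d n)"
      by (simp add: d_def algebra_simps)
    also have "\<dots> \<ge> 0" using ih by (intro add_nonneg_nonneg mult_nonneg_nonneg) auto
    finally have "d (Suc n) \<le> d (Suc (Suc n))" using l by simp
    then show ?case using ih by (simp add: d_def)
  qed
qed

text \<open>Divide Fbar(n) = P(Y=n) + Fbar(n+1) by P(Y=n); up to a constant factor this is the Stein
  equation beyond the jump.\<close>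

lemma poisson_right_rec:
  assumes "0 < l" "n \<ge> 1"
  shows "real n * poisson_right l n = 1 + l * poisson_right l (Suc n)"
proof -
  have "pmf (poisson_pmf l) n > 0" by (rule poisson_pmf_pos[OF assms(1)])
  then show ?thesis
    using assms unfolding poisson_right_def poisson_pmf_Suc[OF assms(1)] poisson_Fbar_Suc[of l n]
    by (simp add: field_simps del: pmf_poisson)
qed

text \<open>The tail series divided termwise by (n+1) P(Y=n+1). The recursion yields this branch as
  a difference, which hides the signs of its increments; the series makes them visible.\<close>

lemma poisson_right_sums:
  assumes "0 < l"
  shows "(\<lambda>i. l ^ i * fact n / fact (Suc n + i)) sums poisson_right l (Suc n)"
proof -
  have "(\<lambda>i. pmf (poisson_pmf l) (Suc n + i) / (real (Suc n) * pmf (poisson_pmf l) (Suc n)))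
      sums poisson_right l (Suc n)"
    unfolding poisson_right_def by (intro sums_divide poisson_Fbar_sums)
  moreover have "pmf (poisson_pmf l) (Suc n + i) / (real (Suc n) * pmf (poisson_pmf l) (Suc n)) =
      l ^ i * fact n / fact (Suc n + i)" for i
    using assms unfolding pmf_poisson[OF assms] fact_Suc[of n] power_add
    by (simp add: field_simps del: of_nat_Suc fact_Suc)
  ultimately show ?thesis by simp
qed

text \<open>Over a common denominator the i-th terms differ by the factor (n+i+2) - (n+1) = i+1, so
  every term is nonnegative.\<close>

lemma poisson_right_diff_sums:
  assumes "0 < l"
  shows "(\<lambda>i. l ^ i * (fact n * real (Suc i) / fact (Suc (Suc n) + i)))
    sums (poisson_right l (Suc n) - poisson_right l (Suc (Suc n)))"
proof -
  have "l ^ i * fact n / fact (Suc n + i) - l ^ i * fact (Suc n) / fact (Suc (Suc n) + i)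
    = l ^ i * (fact n * real (Suc i) / fact (Suc (Suc n) + i))" for i
  proof -
    have f: "(fact (Suc (Suc n) + i) :: real) = (real n + real i + 2) * fact (Suc n + i)"
      "(fact (Suc n) :: real) = (real n + 1) * fact n"
      by (simp_all add: algebra_simps)
    define u v w :: real where "u = fact (Suc n + i)" and "v = fact n" and "w = real n + real i + 2"
    have "u > 0" "w > 0" by (simp_all add: u_def w_def del: fact_Suc)
    then have "l ^ i * v / u - l ^ i * ((real n + 1) * v) / (w * u)
        = l ^ i * (v * (w - (real n + 1)) / (w * u))"
      by (simp add: field_simps)
    moreover have "w - (real n + 1) = real (Suc i)" by (simp add: w_def)
    ultimately show ?thesis
      unfolding f u_def[symmetric] v_def[symmetric] w_def[symmetric] by simp
  qed
  then show ?thesis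
    using sums_diff[OF poisson_right_sums[OF assms, of n] poisson_right_sums[OF assms, of "Suc n"]]
    by simp
qed

text \<open>Termwise comparison: raising n by one multiplies the i-th term of the difference series
  by (n+1) / (n+i+3), which is at most 1.\<close>

lemma poisson_right_convex:
  assumes "0 < l"
  shows "0 \<le> poisson_right l (Suc n) - poisson_right l (Suc (Suc n)) \<and>
    poisson_right l (Suc (Suc n)) - poisson_right l (Suc (Suc (Suc n)))
      \<le> poisson_right l (Suc n) - poisson_right l (Suc (Suc n))"
proof
  show "0 \<le> poisson_right l (Suc n) - poisson_right l (Suc (Suc n))"
    by (rule sums_le[OF _ sums_zero poisson_right_diff_sums[OF assms]]) (use assms in auto)
  show "poisson_right l (Suc (Suc n)) - poisson_right l (Suc (Suc (Suc n)))
      \<le> poisson_right l (Suc n) - poisson_right l (Suc (Suc n))"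
  proof (rule sums_le[OF _ poisson_right_diff_sums[OF assms] poisson_right_diff_sums[OF assms]])
    fix i
    have f: "(fact (Suc (Suc (Suc n)) + i) :: real) = (real n + real i + 3) * fact (Suc (Suc n) + i)"
      "(fact (Suc n) :: real) = (real n + 1) * fact n"
      by (simp_all add: algebra_simps)
    define u v :: real where "u = fact (Suc (Suc n) + i)" and "v = fact n"
    have u: "u > 0" "v > 0" by (simp_all add: u_def v_def del: fact_Suc)
    have "(real n + 1) * v * real (Suc i) / ((real n + real i + 3) * u)
      = (real n + 1) / (real n + real i + 3) * (v * real (Suc i) / u)" by simp
    also have "\<dots> \<le> 1 * (v * real (Suc i) / u)"
      using u by (intro mult_right_mono) auto
    finally have "fact (Suc n) * real (Suc i) / fact (Suc (Suc (Suc n)) + i)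
        \<le> fact n * real (Suc i) / fact (Suc (Suc n) + i)"
      unfolding f u_def[symmetric] v_def[symmetric] by simp
    then show "l ^ i * (fact (Suc n) * real (Suc i) / fact (Suc (Suc (Suc n)) + i))
        \<le> l ^ i * (fact n * real (Suc i) / fact (Suc (Suc n) + i))"
      using assms by (intro mult_left_mono) auto
  qed
qed

lemma poisson_left_incseq:
  assumes "0 < l" shows "incseq (poisson_left l)"
  using poisson_left_convex[OF assms] by (intro incseq_SucI) (meson diff_gt_0_iff_gt less_imp_le)

lemma poisson_left_diff_incseq:
  assumes "0 < l" shows "incseq (\<lambda>n. poisson_left l (Suc n) - poisson_left l n)"
  using poisson_left_convex[OF assms] by (intro incseq_SucI) blast

lemma poisson_right_decseq:
  assumes "0 < l" shows "decseq (\<lambda>n. poisson_right l (Suc n))"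
  using poisson_right_convex[OF assms] by (intro decseq_SucI) (meson diff_ge_0_iff_ge)

lemma poisson_right_diff_decseq:
  assumes "0 < l" shows "decseq (\<lambda>n. poisson_right l (Suc n) - poisson_right l (Suc (Suc n)))"
  using poisson_right_convex[OF assms] by (intro decseq_SucI) blast

lemma poisson_right_nonneg: "0 < l \<Longrightarrow> 0 \<le> poisson_right l n"
  by (simp add: poisson_right_def poisson_Fbar_def)

section \<open>Gluing the branches into one function on the integers\<close>

text \<open>The scale factor that makes the right branch meet the left one at n+1, where the
  indicator jumps.\<close>

definition poisson_ratio :: "real \<Rightarrow> nat \<Rightarrow> real" where
  "poisson_ratio l n = poisson_F l (int n) / poisson_Fbar l (int (Suc n))"

lemma poisson_ratio_nonneg: "0 \<le> poisson_ratio l n"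
  by (simp add: poisson_ratio_def poisson_F_def poisson_Fbar_def)

lemma poisson_left_eq_right:
  assumes "0 < l"
  shows "poisson_left l n = poisson_ratio l n * poisson_right l (Suc n)"
  using poisson_Fbar_pos[OF assms, of "Suc n"]
  unfolding poisson_left_def poisson_ratio_def poisson_right_def poisson_pmf_Suc[OF assms]
  by simp

text \<open>For \<open>j \<ge> 1\<close> this is the solution of the Stein equation for the indicator of \<open>{Suc n..}\<close>,
  divided by minus the Poisson tail probability. The value at \<open>0\<close> does not enter the Stein equation
  on the naturals; it and the negative values are chosen so that the equation also holds at \<open>-1\<close>,
  has error at most 1 below \<open>-1\<close>, and the increments stay below those around \<open>Suc n\<close>.\<close>

definition stein_tail :: "real \<Rightarrow> nat \<Rightarrow> int \<Rightarrow> real" where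
  "stein_tail l n j =
    (if j < 0 then 1 / (l - of_int j) else if j = 0 then 1 / (l + 1)
     else if j \<le> int (Suc n) then poisson_left l (nat j - 1)
     else poisson_ratio l n * poisson_right l (nat j))"

lemma stein_tail_ge:
  assumes "0 < l" "Suc n \<le> m"
  shows "stein_tail l n (int m) = poisson_ratio l n * poisson_right l m"
  using assms poisson_left_eq_right[OF assms(1), of n]
  by (cases "m = Suc n") (auto simp: stein_tail_def nat_add_distrib)

lemma stein_tail_le: "m \<le> n \<Longrightarrow> stein_tail l n (int (Suc m)) = poisson_left l m"
  by (simp add: stein_tail_def nat_add_distrib)

text \<open>Since both branches agree at n+1, no pair j, j+1 with j > 0 straddles them. Bounds,
  increments and the Stein equation can therefore be checked in five separate regimes.\<close>

lemma stein_tail_cases [consumes 1]: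
  assumes "0 < l"
  obtains (below) "j < -1" "stein_tail l n (j + 1) = 1 / (l - of_int j - 1)"
      "stein_tail l n j = 1 / (l - of_int j)"
  | (minus_one) "j = -1" "stein_tail l n (j + 1) = 1 / (l + 1)" "stein_tail l n j = 1 / (l + 1)"
  | (zero) "j = 0" "stein_tail l n (j + 1) = 1 / l" "stein_tail l n j = 1 / (l + 1)"
  | (left) m where "j = int (Suc m)" "m < n"
      "stein_tail l n (j + 1) = poisson_left l (Suc m)" "stein_tail l n j = poisson_left l m"
  | (right) m where "j = int (Suc m)" "n \<le> m"
      "stein_tail l n (j + 1) = poisson_ratio l n * poisson_right l (Suc (Suc m))"
      "stein_tail l n j = poisson_ratio l n * poisson_right l (Suc m)"
proof -
  consider "j < -1" | "j = -1" | "j = 0" | m where "j = int (Suc m)" "m < n" | m where "j = int (Suc m)" "n \<le> m"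
  proof -
    have "\<exists>m. j = int (Suc m)" if "j > 0" using zero_less_imp_eq_int[OF that] by (auto simp: gr0_conv_Suc)
    moreover have "j < -1 \<or> j = -1 \<or> j = 0 \<or> j > 0" by linarith
    ultimately have "j < -1 \<or> j = -1 \<or> j = 0 \<or> (\<exists>m. j = int (Suc m))" by blast
    then show ?thesis using that by (metis not_le)
  qed
  then show ?thesis
  proof cases
    case 1
    then show ?thesis using that(1) by (auto simp: stein_tail_def)
  next
    case 2
    then show ?thesis using that(2) by (auto simp: stein_tail_def)
  next
    case 3
    then show ?thesis using that(3) assms by (auto simp: stein_tail_def poisson_left_0)
  next
    case 4
    then have "j + 1 = int (Suc (Suc m))" by simp
    then show ?thesis
      using that(4)[OF 4] 4 stein_tail_le[of "Suc m" n l] stein_tail_le[of m n l] by simp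
  next
    case 5
    then have "j + 1 = int (Suc (Suc m))" by simp
    then show ?thesis
      using that(5)[OF 5] 5 stein_tail_ge[OF assms, of n "Suc m"] stein_tail_ge[OF assms, of n "Suc (Suc m)"]
      by simp
  qed
qed

text \<open>The peak is at n+1: the left branch increases up to it, the right one decreases after
  it, and the values at arguments \<le> 0 are at most 1/l, the start of the left branch. Boundedness
  later supplies integrability.\<close>

lemma stein_tail_bounds:
  assumes l: "0 < l"
  shows "0 \<le> stein_tail l n j \<and> stein_tail l n j \<le> poisson_left l n"
proof -
  have A: "1 / l \<le> poisson_left l m" for m
    using incseqD[OF poisson_left_incseq[OF l], of 0 m] poisson_left_0[OF l] by simp
  have A1: "1 / (l + 1) \<le> 1 / l" using l by (intro divide_left_mono) auto
  from l show ?thesis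
  proof (cases rule: stein_tail_cases[where j = j and n = n])
    case below
    have "1 / (l - of_int j) \<le> 1 / l" using l below(1) by (intro divide_left_mono) auto
    then show ?thesis using A[of n] l below by auto
  next
    case (left m)
    have "0 \<le> 1 / l" using l by simp
    then show ?thesis
      using A[of m] incseqD[OF poisson_left_incseq[OF l], of m n] left(2) unfolding left(4) by linarith
  next
    case (right m)
    then show ?thesis
      using decseqD[OF poisson_right_decseq[OF l] right(2)] poisson_ratio_nonneg[of l n]
        poisson_right_nonneg[OF l] poisson_left_eq_right[OF l, of n]
      by (auto intro!: mult_left_mono)
  qed (use A[of n] A1 l in auto)
qed

section \<open>The constant \<open>C1\<close>, the increments of the solution and the Stein
  equation\<close>

text \<open>With prefactor A, A (1 - min p q) = max (A - A p) (A - A q). Here A is the value of the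
  solution at the jump k = n+1, and A p and A q are its values at n and n+2; so \<open>C1\<close> is
  the larger of the two increments next to the jump, with left neighbour 0 if n = 0.\<close>

lemma C1_eq_max:
  assumes l: "0 < l"
  shows "C1 l (int (Suc n)) =
    max (poisson_left l n - (if n = 0 then 0 else poisson_left l (n - 1)))
        (poisson_ratio l n * (poisson_right l (Suc n) - poisson_right l (Suc (Suc n))))"
proof -
  let ?A = "poisson_left l n"
  let ?p = "poisson_F l (int (Suc n) - 2) / poisson_F l (int n) * (l / of_int (int (Suc n) - 1))"
  let ?q = "poisson_Fbar l (int (Suc (Suc n))) / poisson_Fbar l (int (Suc n)) * (real (Suc n) / l)"
  have pi: "pmf (poisson_pmf l) m > 0" for m by (rule poisson_pmf_pos[OF l])
  have F: "poisson_F l (int m) > 0" for m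
    unfolding poisson_F_nat using pi by (intro sum_pos) auto
  have "{y. int y = int (Suc n)} = {Suc n}" by auto
  then have pr: "measure_pmf.prob (poisson_pmf l) {y. int y = int (Suc n)} = pmf (poisson_pmf l) (Suc n)"
    by (simp add: measure_pmf_single del: pmf_poisson)
  have "C1 l (int (Suc n)) = ?A * (1 - min ?p ?q)"
  proof -
    have i: "int (Suc n) - 1 = int n" "int (Suc n) + 1 = int (Suc (Suc n))" by auto
    have "of_int (int (Suc n)) * pmf (poisson_pmf l) (Suc n) = l * pmf (poisson_pmf l) n"
      using poisson_pmf_Suc[OF l, of n] by (simp del: pmf_poisson)
    then show ?thesis
      unfolding C1_def pr poisson_left_def i by simp
  qed
  also have "\<dots> = max (?A - ?A * ?p) (?A - ?A * ?q)"
  proof -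
    have "?A > 0" using F[of n] pi[of n] l by (simp add: poisson_left_def del: pmf_poisson)
    then have "?A * (1 - min ?p ?q) = ?A - min (?A * ?p) (?A * ?q)"
      by (simp only: right_diff_distrib mult_1_right min_mult_distrib_left) simp
    then show ?thesis by linarith
  qed
  \<comment> \<open>For \<open>n = 0\<close> the factor \<open>l / 0\<close> is 0, in accordance
    with F(-1) = 0.\<close>
  also have "?A * ?p = (if n = 0 then 0 else poisson_left l (n - 1))"
  proof (cases n)
    case (Suc m)
    have i: "int (Suc n) - 2 = int m" "of_int (int (Suc n) - 1) = real (Suc m)" using Suc by auto
    have "real (Suc m) * pmf (poisson_pmf l) (Suc m) = l * pmf (poisson_pmf l) m"
      by (rule poisson_pmf_Suc[OF l])
    then show ?thesis
      using F[of n] l pi[of m] pi[of n] unfolding poisson_left_def i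
      by (simp add: Suc field_simps del: pmf_poisson of_nat_Suc)
  qed simp
  also have "?A - ?A * ?q = poisson_ratio l n * (poisson_right l (Suc n) - poisson_right l (Suc (Suc n)))"
  proof -
    have e: "l * pmf (poisson_pmf l) n = real (Suc n) * pmf (poisson_pmf l) (Suc n)"
      "real (Suc (Suc n)) * pmf (poisson_pmf l) (Suc (Suc n)) = l * pmf (poisson_pmf l) (Suc n)"
      by (simp_all only: poisson_pmf_Suc[OF l])
    have "?A * ?q = poisson_ratio l n * poisson_right l (Suc (Suc n))"
      using l pi[of "Suc n"] poisson_Fbar_pos[OF l, of "Suc n"]
      unfolding poisson_left_def poisson_ratio_def poisson_right_def e
      by (simp add: field_simps del: pmf_poisson of_nat_Suc)
    then show ?thesis
      using poisson_left_eq_right[OF l, of n] by (simp add: right_diff_distrib)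
  qed
  finally show ?thesis .
qed

text \<open>Convexity handles the positive arguments. The increments at negative j are at most the
  one from 0 to 1, so only that one has to be compared with \<open>C1\<close>.\<close>

lemma stein_tail_diff:
  assumes l: "0 < l"
  shows "\<bar>stein_tail l n (j + 1) - stein_tail l n j\<bar> \<le> C1 l (int (Suc n))"
proof -
  let ?C = "C1 l (int (Suc n))"
  have C_left: "poisson_left l (Suc m) - poisson_left l m \<le> ?C" if m: "m < n" for m
  proof -
    obtain n' where n': "n = Suc n'" using m by (cases n) auto
    have "poisson_left l (Suc m) - poisson_left l m \<le> poisson_left l n - poisson_left l (n - 1)"
      using incseqD[OF poisson_left_diff_incseq[OF l], of m n'] m n' by simp
    then show ?thesis using n' unfolding C1_eq_max[OF l] by simp
  qed
  \<comment> \<open>The increment 1/l - 1/(l+1) from 0 to 1. It is at most 1/l, the first entry of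
    the maximum when n = 0, and at most 1/l^2, the first increment of the left branch, when n >
    0.\<close>
  have C_zero: "1 / (l * (l + 1)) \<le> ?C"
  proof (cases "n = 0")
    case True
    have "1 / (l * (l + 1)) \<le> 1 / l"
      using l by (intro divide_left_mono) auto
    also have "1 / l \<le> ?C"
      using True poisson_left_0[OF l] unfolding C1_eq_max[OF l] by simp
    finally show ?thesis .
  next
    case False
    have "1 / (l * (l + 1)) \<le> 1 / (l * l)"
      using l by (intro divide_left_mono) (auto intro!: mult_left_mono)
    also have "\<dots> = poisson_left l (Suc 0) - poisson_left l 0"
      using poisson_left_Suc[OF l, of 0] l by (simp add: poisson_left_0 field_simps)
    also have "\<dots> \<le> ?C" using False by (intro C_left) auto
    finally show ?thesis .
  qed
  from l show ?thesis
  proof (cases rule: stein_tail_cases[where j = j and n = n])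
    case below
    have jr: "of_int j \<le> (-2::real)" using below(1) by linarith
    have "stein_tail l n (j + 1) - stein_tail l n j = 1 / ((l - of_int j - 1) * (l - of_int j))"
      unfolding below(2,3) using l jr by (simp add: field_simps)
    \<comment> \<open>As j \<le> -2, the factors l-j-1 and l-j exceed l and l+1.\<close>
    moreover have "\<dots> \<le> 1 / (l * (l + 1))"
      using l jr by (intro divide_left_mono mult_mono mult_pos_pos) auto
    moreover have "0 \<le> 1 / ((l - of_int j - 1) * (l - of_int j))" using l jr by simp
    ultimately show ?thesis using C_zero by linarith
  next
    case minus_one
    have "0 \<le> 1 / (l * (l + 1))" using l by simp
    then have "0 \<le> ?C" using C_zero by linarith
    then show ?thesis unfolding minus_one(2,3) by simp
  next
    case zero
    have "stein_tail l n (j + 1) - stein_tail l n j = 1 / (l * (l + 1))"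
      unfolding zero(2,3) using l by (simp add: field_simps)
    moreover have "0 \<le> 1 / (l * (l + 1))" using l by simp
    ultimately show ?thesis using C_zero by linarith
  next
    case (left m)
    then show ?thesis
      using C_left[OF left(2)] incseq_SucD[OF poisson_left_incseq[OF l], of m] by simp
  next
    case (right m)
    have "\<bar>stein_tail l n (j + 1) - stein_tail l n j\<bar> =
        \<bar>poisson_ratio l n * (poisson_right l (Suc m) - poisson_right l (Suc (Suc m)))\<bar>"
      unfolding right(3,4) by (simp add: abs_minus_commute right_diff_distrib)
    also have "\<dots> = poisson_ratio l n * (poisson_right l (Suc m) - poisson_right l (Suc (Suc m)))"
      using poisson_right_convex[OF l, of m] poisson_ratio_nonneg[of l n] by simp
    also have "\<dots> \<le> poisson_ratio l n * (poisson_right l (Suc n) - poisson_right l (Suc (Suc n)))"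
      using decseqD[OF poisson_right_diff_decseq[OF l] right(2)] poisson_ratio_nonneg[of l n]
      by (intro mult_left_mono) auto
    also have "\<dots> \<le> ?C" unfolding C1_eq_max[OF l] by simp
    finally show ?thesis .
  qed
qed

text \<open>From 0 to n the Stein operator gives 1, by the left recursion and g(1) = 1/l. Beyond,
  the right recursion gives minus the ratio, which is 1 - 1/Fbar(n+1) because F(n) + Fbar(n+1) = 1.
  The error allowed below -1 is the source of the term P(W-a < -1).\<close>

lemma stein_tail_equation:
  assumes l: "0 < l"
  shows "\<bar>(of_bool (int (Suc n) \<le> j) / poisson_Fbar l (int (Suc n)) - 1)
      + (l * stein_tail l n (j + 1) - of_int j * stein_tail l n j)\<bar> \<le> of_bool (j < -1)"
  using l
proof (cases rule: stein_tail_cases[where j = j and n = n])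
  case below
  have jr: "of_int j \<le> (-2::real)" using below(1) by linarith
  \<comment> \<open>The left side is the absolute value of -1 plus these two fractions; each lies in
    [0,1], so the sum lies in [-1,1].\<close>
  have "0 \<le> l / (l - of_int j - 1)" "l / (l - of_int j - 1) \<le> 1"
    "0 \<le> - of_int j / (l - of_int j)" "- of_int j / (l - of_int j) \<le> 1"
    using l jr by (auto simp: divide_simps)
  then show ?thesis using below by simp
next
  case minus_one
  \<comment> \<open>With g(-1) = g(0), the equation l g(0) + g(-1) = 1 forces the common value
    1/(l+1).\<close>
  have "l * (1 / (l + 1)) + 1 / (l + 1) = 1" using l by (simp add: field_simps)
  then show ?thesis unfolding minus_one(2,3) using minus_one(1) by simp
next
  case zero
  then show ?thesis using l by simp
next
  case (left m)
  then show ?thesis using poisson_left_Suc[OF l, of m] by simp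
next
  case (right m)
  have "l * stein_tail l n (j + 1) - of_int j * stein_tail l n j =
    - poisson_ratio l n * (real (Suc m) * poisson_right l (Suc m) - l * poisson_right l (Suc (Suc m)))"
    unfolding right(3,4) using right(1) by (simp add: algebra_simps)
  also have "real (Suc m) * poisson_right l (Suc m) - l * poisson_right l (Suc (Suc m)) = 1"
    using poisson_right_rec[OF l, of "Suc m"] by simp
  also have "- poisson_ratio l n * 1 = 1 - 1 / poisson_Fbar l (int (Suc n))"
  proof -
    have "poisson_F l (int n) = 1 - poisson_Fbar l (int (Suc n))"
      using poisson_F_Fbar[of l n] by linarith
    then show ?thesis
      using poisson_Fbar_pos[OF l, of "Suc n"] by (simp add: poisson_ratio_def diff_divide_distrib)
  qed
  finally show ?thesis using right(1,2) by simp
qed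

section \<open>Size-bias coupling and the expectation of the Stein operator\<close>

text \<open>Telescoping; needed because W+1-a and Ws-a may lie many integers apart.\<close>

lemma lipschitz_int:
  fixes g :: "int \<Rightarrow> real"
  assumes "\<And>j. \<bar>g (j + 1) - g j\<bar> \<le> C"
  shows "\<bar>g x - g y\<bar> \<le> C * \<bar>of_int x - of_int y\<bar>"
proof -
  have up: "\<bar>g (y + int n) - g y\<bar> \<le> C * real n" for y n
  proof (induction n)
    case (Suc n)
    have "\<bar>g (y + int (Suc n)) - g (y + int n)\<bar> \<le> C"
      using assms[of "y + int n"] by (simp add: ac_simps)
    then show ?case using Suc by (simp add: algebra_simps)
  qed simp
  show ?thesis
  proof (cases "y \<le> x")
    case True
    then show ?thesis using up[of y "nat (x - y)"] by simp
  next
    case False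
    then show ?thesis using up[of x "nat (y - x)"] by (simp add: abs_minus_commute)
  qed
qed

locale size_bias_coupling = prob_space M for M :: "'a measure" +
  fixes W :: "'a \<Rightarrow> nat" and Ws :: "'a \<Rightarrow> real" and \<mu> :: real
  assumes W_meas: "W \<in> measurable M (count_space UNIV)"
    and W_int: "integrable M (\<lambda>\<omega>. real (W \<omega>))"
    and W_mean: "expectation (\<lambda>\<omega>. real (W \<omega>)) = \<mu>"
    and mean_pos: "0 < \<mu>"
    and Ws_meas: "Ws \<in> borel_measurable M"
    and Ws_distr: "distr M borel Ws = size_biased (distr M borel (\<lambda>\<omega>. real (W \<omega>)))"
begin

lemma rW_meas: "(\<lambda>\<omega>. real (W \<omega>)) \<in> borel_measurable M"
  using measurable_compose[OF W_meas, of real borel] by simp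

lemma W_comp_meas: "(\<lambda>\<omega>. h (W \<omega>)) \<in> borel_measurable M" for h :: "nat \<Rightarrow> real"
  using measurable_compose[OF W_meas, of h borel] by simp

lemma size_biased_W:
  "distr M borel Ws = density (distr M borel (\<lambda>\<omega>. real (W \<omega>))) (\<lambda>w. ennreal (w / \<mu>))"
  using Ws_distr W_mean by (simp add: size_biased_def integral_distr[OF rW_meas])

lemma AE_distr_W_nonneg: "AE w in distr M borel (\<lambda>\<omega>. real (W \<omega>)). 0 \<le> w / \<mu>"
  using mean_pos by (subst AE_distr_iff[OF rW_meas]) auto

text \<open>Pass to the law of W, where size biasing is the density w/\<mu>, and pull back to the
  probability space.\<close>

lemma expectation_size_biased:
  assumes "\<phi> \<in> borel_measurable borel"
  shows "\<mu> * expectation (\<lambda>\<omega>. \<phi> (Ws \<omega>)) = expectation (\<lambda>\<omega>. real (W \<omega>) * \<phi> (real (W \<omega>)))"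
proof -
  have "expectation (\<lambda>\<omega>. \<phi> (Ws \<omega>)) = integral\<^sup>L (distr M borel Ws) \<phi>"
    using assms by (simp add: integral_distr[OF Ws_meas])
  also have "\<dots> = (\<integral>w. (w / \<mu>) *\<^sub>R \<phi> w \<partial>distr M borel (\<lambda>\<omega>. real (W \<omega>)))"
    unfolding size_biased_W using assms AE_distr_W_nonneg by (intro integral_density) auto
  also have "\<dots> = expectation (\<lambda>\<omega>. (real (W \<omega>) / \<mu>) *\<^sub>R \<phi> (real (W \<omega>)))"
    using assms by (intro integral_distr[OF rW_meas]) auto
  finally show ?thesis using mean_pos by simp
qed

text \<open>Used in both directions: bounded \<open>\<phi>\<close> gives integrability of W
  \<phi>(W), and the identity gives that of \<open>Ws\<close> from the second moment of W.\<close>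

lemma integrable_size_biased:
  assumes "\<phi> \<in> borel_measurable borel"
  shows "integrable M (\<lambda>\<omega>. \<phi> (Ws \<omega>)) \<longleftrightarrow> integrable M (\<lambda>\<omega>. real (W \<omega>) * \<phi> (real (W \<omega>)))"
proof -
  have "integrable M (\<lambda>\<omega>. \<phi> (Ws \<omega>)) \<longleftrightarrow> integrable (distr M borel Ws) \<phi>"
    using assms by (simp add: integrable_distr_eq[OF Ws_meas])
  also have "\<dots> \<longleftrightarrow> integrable (distr M borel (\<lambda>\<omega>. real (W \<omega>))) (\<lambda>w. (w / \<mu>) *\<^sub>R \<phi> w)"
    unfolding size_biased_W using assms AE_distr_W_nonneg by (intro integrable_density) auto
  also have "\<dots> \<longleftrightarrow> integrable M (\<lambda>\<omega>. (real (W \<omega>) / \<mu>) *\<^sub>R \<phi> (real (W \<omega>)))"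
    using assms by (intro integrable_distr_eq[OF rW_meas]) auto
  also have "\<dots> \<longleftrightarrow> integrable M (\<lambda>\<omega>. (1 / \<mu>) * (real (W \<omega>) * \<phi> (real (W \<omega>))))"
    by (simp add: mult.commute)
  finally show ?thesis using mean_pos by (simp only: integrable_mult_left_iff) simp
qed

text \<open>The size-biased law has a density with respect to the law of W and inherits its null set
  of non-integers. So a function on the integers can be evaluated at the real-valued
  \<open>Ws\<close> by rounding down.\<close>

lemma AE_size_biased_floor: "AE \<omega> in M. of_int \<lfloor>Ws \<omega>\<rfloor> = Ws \<omega>"
proof -
  have "AE w in distr M borel (\<lambda>\<omega>. real (W \<omega>)). of_int \<lfloor>w\<rfloor> = w"
    by (subst AE_distr_iff[OF rW_meas]) auto
  then have "AE w in distr M borel Ws. of_int \<lfloor>w\<rfloor> = w"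
    unfolding size_biased_W by (subst AE_density) auto
  then show ?thesis by (subst (asm) AE_distr_iff[OF Ws_meas]) auto
qed

text \<open>Size biasing replaces E[W g(W-a)] by \<mu> E g(Ws-a). The Lipschitz bound then controls
  the difference from \<mu> E g(W+1-a), and a single increment controls the remaining term with
  factor a. The bound \<open>K\<close> provides integrability.\<close>

lemma size_bias_stein_bound:
  fixes g :: "int \<Rightarrow> real" and a :: int
  assumes W2: "integrable M (\<lambda>\<omega>. (real (W \<omega>))\<^sup>2)"
    and lip: "\<And>j. \<bar>g (j + 1) - g j\<bar> \<le> C"
    and bd: "\<And>j. \<bar>g j\<bar> \<le> K"
  shows "\<bar>expectation (\<lambda>\<omega>. (\<mu> - of_int a) * g (int (W \<omega>) - a + 1)
        - of_int (int (W \<omega>) - a) * g (int (W \<omega>) - a))\<bar>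
    \<le> C * (\<mu> * expectation (\<lambda>\<omega>. \<bar>real (W \<omega>) + 1 - Ws \<omega>\<bar>) + \<bar>of_int a\<bar>)"
    and "integrable M (\<lambda>\<omega>. (\<mu> - of_int a) * g (int (W \<omega>) - a + 1)
        - of_int (int (W \<omega>) - a) * g (int (W \<omega>) - a))"
proof -
  define G0 where "G0 \<omega> = g (int (W \<omega>) - a)" for \<omega>
  define G1 where "G1 \<omega> = g (int (W \<omega>) - a + 1)" for \<omega>
  define Gs where "Gs \<omega> = g (\<lfloor>Ws \<omega>\<rfloor> - a)" for \<omega>
  have \<phi>: "(\<lambda>w::real. g (\<lfloor>w\<rfloor> - a)) \<in> borel_measurable borel"
    by (rule measurable_compose[OF measurable_real_floor, where g = "\<lambda>i. g (i - a)"]) simp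
  have m: "G0 \<in> borel_measurable M" "G1 \<in> borel_measurable M"
    unfolding G0_def G1_def by (rule W_comp_meas)+
  have ms: "Gs \<in> borel_measurable M"
    unfolding Gs_def by (rule measurable_compose[OF Ws_meas \<phi>])
  have i: "integrable M G0" "integrable M G1" "integrable M Gs"
    using m ms bd by (auto intro!: integrable_const_bound[of _ K] simp: G0_def G1_def Gs_def)
  have iW: "integrable M (\<lambda>\<omega>. real (W \<omega>) * G0 \<omega>)"
    using i(3) integrable_size_biased[OF \<phi>] by (simp add: Gs_def[abs_def] G0_def)
  have bias: "expectation (\<lambda>\<omega>. real (W \<omega>) * G0 \<omega>) = \<mu> * expectation Gs"
    using expectation_size_biased[OF \<phi>] by (simp add: Gs_def[abs_def] G0_def)
  have iWs: "integrable M Ws"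
    using W2 integrable_size_biased[of "\<lambda>w. w"] by (simp add: power2_eq_square)
  have iabs: "integrable M (\<lambda>\<omega>. \<bar>real (W \<omega>) + 1 - Ws \<omega>\<bar>)"
    using iWs W_int by auto
  have split: "(\<mu> - of_int a) * g (int (W \<omega>) - a + 1) - of_int (int (W \<omega>) - a) * g (int (W \<omega>) - a)
     = (\<mu> * G1 \<omega> - real (W \<omega>) * G0 \<omega>) - of_int a * (G1 \<omega> - G0 \<omega>)" for \<omega>
    by (simp add: G0_def G1_def algebra_simps)
  show "integrable M (\<lambda>\<omega>. (\<mu> - of_int a) * g (int (W \<omega>) - a + 1)
        - of_int (int (W \<omega>) - a) * g (int (W \<omega>) - a))"
    unfolding split using i iW by auto
  have expand: "expectation (\<lambda>\<omega>. (\<mu> * G1 \<omega> - real (W \<omega>) * G0 \<omega>) - of_int a * (G1 \<omega> - G0 \<omega>))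
     = \<mu> * expectation (\<lambda>\<omega>. G1 \<omega> - Gs \<omega>) - of_int a * expectation (\<lambda>\<omega>. G1 \<omega> - G0 \<omega>)"
    using i iW bias by (simp add: right_diff_distrib)
  have Gs_bound: "\<bar>expectation (\<lambda>\<omega>. G1 \<omega> - Gs \<omega>)\<bar> \<le> C * expectation (\<lambda>\<omega>. \<bar>real (W \<omega>) + 1 - Ws \<omega>\<bar>)"
  proof -
    have "\<bar>expectation (\<lambda>\<omega>. G1 \<omega> - Gs \<omega>)\<bar> \<le> expectation (\<lambda>\<omega>. \<bar>G1 \<omega> - Gs \<omega>\<bar>)"
      by (rule integral_abs_bound)
    also have "\<dots> \<le> expectation (\<lambda>\<omega>. C * \<bar>real (W \<omega>) + 1 - Ws \<omega>\<bar>)"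
    proof (rule integral_mono_AE)
      show "AE \<omega> in M. \<bar>G1 \<omega> - Gs \<omega>\<bar> \<le> C * \<bar>real (W \<omega>) + 1 - Ws \<omega>\<bar>"
        using AE_size_biased_floor
      proof eventually_elim
        case (elim \<omega>)
        \<comment> \<open>The shift by a cancels, and where \<open>Ws\<close> is an integer the
          distance of the arguments is exactly |W+1-Ws|.\<close>
        have "\<bar>G1 \<omega> - Gs \<omega>\<bar> \<le> C * \<bar>of_int (int (W \<omega>) - a + 1) - of_int (\<lfloor>Ws \<omega>\<rfloor> - a)\<bar>"
          unfolding G1_def Gs_def by (rule lipschitz_int[where g = g, OF lip])
        also have "of_int (int (W \<omega>) - a + 1) - of_int (\<lfloor>Ws \<omega>\<rfloor> - a) = real (W \<omega>) + 1 - Ws \<omega>"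
          unfolding of_int_diff elim by simp
        finally show ?case .
      qed
    qed (use i iabs in auto)
    finally show ?thesis by simp
  qed
  have G0_bound: "\<bar>expectation (\<lambda>\<omega>. G1 \<omega> - G0 \<omega>)\<bar> \<le> C"
  proof -
    have "\<bar>expectation (\<lambda>\<omega>. G1 \<omega> - G0 \<omega>)\<bar> \<le> expectation (\<lambda>\<omega>. C)"
    proof (intro order_trans[OF integral_abs_bound] integral_mono)
      show "\<bar>G1 \<omega> - G0 \<omega>\<bar> \<le> C" for \<omega>
        using lip by (simp add: G0_def G1_def)
    qed (use i in auto)
    then show ?thesis by (simp add: prob_space)
  qed
  show "\<bar>expectation (\<lambda>\<omega>. (\<mu> - of_int a) * g (int (W \<omega>) - a + 1)
        - of_int (int (W \<omega>) - a) * g (int (W \<omega>) - a))\<bar>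
    \<le> C * (\<mu> * expectation (\<lambda>\<omega>. \<bar>real (W \<omega>) + 1 - Ws \<omega>\<bar>) + \<bar>of_int a\<bar>)"
  proof -
    have "\<bar>\<mu> * expectation (\<lambda>\<omega>. G1 \<omega> - Gs \<omega>)\<bar> \<le> \<mu> * (C * expectation (\<lambda>\<omega>. \<bar>real (W \<omega>) + 1 - Ws \<omega>\<bar>))"
      using Gs_bound mean_pos by (simp add: abs_mult)
    moreover have "\<bar>of_int a * expectation (\<lambda>\<omega>. G1 \<omega> - G0 \<omega>)\<bar> \<le> \<bar>of_int a\<bar> * C"
      using G0_bound by (simp add: abs_mult mult_left_mono)
    moreover have "C * (\<mu> * expectation (\<lambda>\<omega>. \<bar>real (W \<omega>) + 1 - Ws \<omega>\<bar>) + \<bar>of_int a\<bar>)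
        = \<mu> * (C * expectation (\<lambda>\<omega>. \<bar>real (W \<omega>) + 1 - Ws \<omega>\<bar>)) + \<bar>of_int a\<bar> * C"
      by (simp add: distrib_left mult.left_commute mult.commute)
    ultimately show ?thesis unfolding split expand by linarith
  qed
qed

end

section \<open>From the Stein equation to the relative error of the tail\<close>

theorem theorem2p7:
  fixes M :: "'a measure" and W :: "'a \<Rightarrow> nat" and Ws :: "'a \<Rightarrow> real"
    and \<mu> \<sigma> lam :: real and a k :: int
  assumes "prob_space M"
    and "W \<in> measurable M (count_space UNIV)"
    and "integrable M (\<lambda>\<omega>. real (W \<omega>))"
    and "integrable M (\<lambda>\<omega>. (real (W \<omega>))\<^sup>2)"
    and "prob_space.expectation M (\<lambda>\<omega>. real (W \<omega>)) = \<mu>"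
    and "prob_space.variance M (\<lambda>\<omega>. real (W \<omega>)) = \<sigma>\<^sup>2"
    and "0 < \<mu>"
    and "Ws \<in> borel_measurable M"
    and "distr M borel Ws = size_biased (distr M borel (\<lambda>\<omega>. real (W \<omega>)))"
    and "of_int a < \<mu>"
    and "lam = \<mu> - of_int a"
    and "of_int k > lam"
  shows "\<bar>\<P>(\<omega> in M. int (W \<omega>) - a \<ge> k) / measure_pmf.prob (poisson_pmf lam) {y. int y \<ge> k} - 1\<bar>
    \<le> C1 lam k * (\<mu> * prob_space.expectation M (\<lambda>\<omega>. \<bar>real (W \<omega>) + 1 - Ws \<omega>\<bar>) + \<bar>\<mu> - lam\<bar>)
      + \<P>(\<omega> in M. int (W \<omega>) - a < -1)"
proof -
  interpret size_bias_coupling M W Ws \<mu>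
    unfolding size_bias_coupling_def size_bias_coupling_axioms_def using assms by blast
  have l: "0 < lam" using assms(10,11) by simp
  have "0 < k" using l assms(12) by linarith
  \<comment> \<open>Writing k = n+1 matches the index shift of \<open>poisson_left\<close>.\<close>
  then obtain n where k: "k = int (Suc n)"
    using zero_less_imp_eq_int[of k] by (auto simp: gr0_conv_Suc)
  define Q where "Q = poisson_Fbar lam k"
  define g where "g = stein_tail lam n"
  define X where "X \<omega> = int (W \<omega>) - a" for \<omega>
  \<comment> \<open>\<open>S\<close> is the Stein operator applied to \<open>g\<close> at X, with
    \<open>lam\<close> spelled out; the expectation of \<open>D\<close> below is the signed relative
    error.\<close>
  define S where "S \<omega> = (\<mu> - of_int a) * g (X \<omega> + 1) - of_int (X \<omega>) * g (X \<omega>)" for \<omega>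
  define D where "D \<omega> = of_bool (k \<le> X \<omega>) / Q - 1" for \<omega>
  have bd: "\<bar>g j\<bar> \<le> poisson_left lam n" for j
    using stein_tail_bounds[OF l, of n j] by (simp add: g_def)
  have lip: "\<bar>g (j + 1) - g j\<bar> \<le> C1 lam k" for j
    unfolding g_def k by (rule stein_tail_diff[OF l])
  note S = size_bias_stein_bound[where g = g and a = a, OF assms(4) lip bd, folded X_def, folded S_def]
  have prob: "expectation (\<lambda>\<omega>. of_bool (P (X \<omega>))) = \<P>(\<omega> in M. P (X \<omega>))"
    and int: "integrable M (\<lambda>\<omega>. of_bool (P (X \<omega>)) :: real)" for P
  proof -
    have sets: "{\<omega> \<in> space M. P (X \<omega>)} \<in> sets M"
      using measurable_sets[OF W_meas, of "{w. P (int w - a)}"]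
      by (simp add: X_def vimage_def Int_def conj_commute)
    have "expectation (\<lambda>\<omega>. of_bool (P (X \<omega>))) = expectation (indicat_real {\<omega> \<in> space M. P (X \<omega>)})"
      by (intro Bochner_Integration.integral_cong) (auto simp: indicator_def)
    then show "expectation (\<lambda>\<omega>. of_bool (P (X \<omega>))) = \<P>(\<omega> in M. P (X \<omega>))"
      using sets by simp
    show "integrable M (\<lambda>\<omega>. of_bool (P (X \<omega>)) :: real)"
      unfolding X_def using W_comp_meas
      by (intro integrable_const_bound[of _ 1]) auto
  qed
  have D: "integrable M D" "expectation D = \<P>(\<omega> in M. k \<le> X \<omega>) / Q - 1"
    unfolding D_def[abs_def] using int[of "\<lambda>j. k \<le> j"] prob[of "\<lambda>j. k \<le> j"]
    by (simp_all add: prob_space)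
  \<comment> \<open>By the pointwise Stein equation, E D differs from -E S by at most P(X < -1), so
    the bound on E S carries over to E D.\<close>
  have "\<bar>expectation (\<lambda>\<omega>. D \<omega> + S \<omega>)\<bar> \<le> expectation (\<lambda>\<omega>. of_bool (X \<omega> < -1) :: real)"
  proof (intro order_trans[OF integral_abs_bound] integral_mono)
    show "integrable M (\<lambda>\<omega>. \<bar>D \<omega> + S \<omega>\<bar>)"
      using D(1) S(2) by (intro integrable_abs Bochner_Integration.integrable_add)
    show "integrable M (\<lambda>\<omega>. of_bool (X \<omega> < -1) :: real)" by (rule int)
    show "\<bar>D \<omega> + S \<omega>\<bar> \<le> of_bool (X \<omega> < -1)" for \<omega>
      using stein_tail_equation[OF l, of n "X \<omega>"] assms(11) unfolding D_def S_def Q_def g_def k by simp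
  qed
  then have "\<bar>expectation D + expectation S\<bar> \<le> \<P>(\<omega> in M. X \<omega> < -1)"
    using D(1) S(2) prob[of "\<lambda>j. j < -1"] by simp
  then have "\<bar>expectation D\<bar> \<le> C1 lam k * (\<mu> * expectation (\<lambda>\<omega>. \<bar>real (W \<omega>) + 1 - Ws \<omega>\<bar>) + \<bar>of_int a\<bar>)
      + \<P>(\<omega> in M. X \<omega> < -1)"
    using S(1) by linarith
  \<comment> \<open>Since \<open>lam = \<mu> - a\<close>, the term |a| is |\<mu> - lam|.\<close>
  then show ?thesis
    unfolding D(2) using assms(11) by (simp add: X_def Q_def poisson_Fbar_def)
qed

end
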